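(* Let $G$ be a short impartial game such that there exist three short impartial games $G_1, H_1, H_2$ with $g(H_1)=g(H_2)=1$ and $G\equiv G_1+H_1+H_2$. Then $$g(G)=1 \iff s(G)=1.$$
   Context: All games are short impartial games under normal play (a player unable to move loses): a position is identified with its finite set of options, which are themselves short impartial games; there are no infinite plays. The empty game (no options) is denoted $0$. $G\equiv H$ means that $G$ and $H$ have the same option sets (are identical as games). $G+H$ is the disjunctive sum. $G=H$ means that for every impartial game $X$, $G+X$ and $H+X$ have the same outcome (i.e. the same player, previous or next, has a winning strategy); in particular $G=0$ iff the previous player wins $G$ (a $\mathcal P$-position). The nimber $*n$ is the game with options $*k$, $0\le k<n$. The Grundy value $g(G)$ is the unique non-negative integer $n$ with $G=*n$. The split sum $G\circ H$ is defined recursively by: $G\circ H\equiv 0$ if $G\equiv 0$; $G\circ H\equiv G$ if $H\equiv 0$; and otherwise $G\circ H\equiv\{G\circ h,\ g\circ H\}$, where $g$ ranges over the options of $G$ and $h$ over the options of $H$. For a nonempty game $G$, the split value $s(G)$ is the non-negative integer $n$ such that $G\circ( *n)=0$ if such $n$ exists (it is then unique), and $s(G)=\infty$ if $G\circ( *n)\neq 0$ for all $n$. *)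

theory Defs
  imports "HOL-Library.FSet" "HOL-Library.Extended_Nat"
begin

text \<open>
  Well-foundedness of the datatype rules out infinite plays, and finite option sets make the games
  short. HOL equality on \<open>game\<close> is identity of option sets (\<open>G \<equiv> H\<close>); equality of games
  in the sense of outcomes is the coarser relation \<open>\<doteq>\<close> below.
\<close>

datatype game = Game (options: "game fset")

lemma size_option_less: "g |\<in>| options G \<Longrightarrow> size g < size G"
proof -
  assume g: "g |\<in>| options G"
  have "Suc (size g) \<le> (\<Sum>x\<in>fset (options G). Suc (size x))"
    using g by (intro member_le_sum) auto
  then show "size g < size G"
    by (cases G) auto
qed

instantiation game :: zero
begin

definition zero_game :: game where
  "0 = Game {||}"

instance ..

end

instantiation game :: plus
begin

function plus_game :: "game \<Rightarrow> game \<Rightarrow> game" where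
  "G + H = Game ((\<lambda>g. g + H) |`| options G |\<union>| (\<lambda>h. G + h) |`| options H)"
  by pat_completeness auto
termination
  by (relation "measure (\<lambda>(G, H). size G + size H)") (auto simp: size_option_less)

instance ..

end

declare plus_game.simps [simp del]

text \<open>
  Normal play: the previous player wins iff every move leads to a position that is lost
  for whoever moved there. By determinacy, the next player wins exactly in the remaining positions.
\<close>

function previous_wins :: "game \<Rightarrow> bool" where
  "previous_wins G \<longleftrightarrow> (\<forall>g. g |\<in>| options G \<longrightarrow> \<not> previous_wins g)"
  by pat_completeness auto
termination
  by (relation "measure size") (auto simp: size_option_less)

declare previous_wins.simps [simp del]

definition game_eq :: "game \<Rightarrow> game \<Rightarrow> bool" (infix "\<doteq>" 50) where
  "G \<doteq> H \<longleftrightarrow> (\<forall>X. previous_wins (G + X) \<longleftrightarrow> previous_wins (H + X))"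

fun nimber :: "nat \<Rightarrow> game" where
  "nimber n = Game (fset_of_list (map nimber [0..<n]))"

declare nimber.simps [simp del]

definition grundy :: "game \<Rightarrow> nat" where
  "grundy G = (THE n. G \<doteq> nimber n)"

function split_sum :: "game \<Rightarrow> game \<Rightarrow> game" where
  "split_sum G H =
    (if G = 0 then 0
     else if H = 0 then G
     else Game ((\<lambda>h. split_sum G h) |`| options H |\<union>| (\<lambda>g. split_sum g H) |`| options G))"
  by pat_completeness auto
termination
  by (relation "measure (\<lambda>(G, H). size G + size H)") (auto simp: size_option_less)

declare split_sum.simps [simp del]

text \<open>Only meaningful for \<open>G \<noteq> 0\<close>, since \<open>split_sum 0 H = 0\<close> for every \<open>H\<close>.\<close>

definition split_value :: "game \<Rightarrow> enat" where
  "split_value G =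
    (if \<exists>n. split_sum G (nimber n) \<doteq> 0 then enat (THE n. split_sum G (nimber n) \<doteq> 0) else \<infinity>)"

end

theory Submission
  imports Defs
begin

text \<open>
  Split sum with \<open>*1\<close> is ordinary play on \<open>G\<close> in which the two players share a single pass, with one
  twist: once \<open>G\<close> is exhausted the pass is void. Hence \<open>G \<circ> *1\<close> differs from \<open>G + *1\<close>, which is
  lost for the player to move exactly when \<open>g(G) = 1\<close>, only in the positions where the pass outlives
  \<open>G\<close>. The theorem says that two summands \<open>H\<^sub>1\<close>, \<open>H\<^sub>2\<close> of Grundy value 1 make this difference
  harmless.

  For a nonempty \<open>G\<close>, the position \<open>G \<circ> *1\<close> is lost for the player to move iff \<open>g(G) \<noteq> 0\<close> and
  every option \<open>g\<close> of \<open>G\<close> has \<open>g \<circ> *1\<close> won (lemma \<open>previous_wins_split_one_iff\<close>). Take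
  \<open>G = G\<^sub>1 + H\<^sub>1 + H\<^sub>2\<close>, which is nonempty with \<open>g(G) = g(G\<^sub>1)\<close>, and argue by induction
  (lemma \<open>previous_wins_split_one_iff_grundy\<close>).

  If \<open>g(G) = 0\<close>, the player to move uses the pass. If \<open>g(G) \<ge> 2\<close>, he moves in \<open>G\<^sub>1\<close> to Grundy value
  1; this keeps the shape of the position, and the induction hypothesis applies. If \<open>g(G) = 1\<close>, every
  move has a refutation: a move in \<open>G\<^sub>1\<close> leads to a position of the same shape with Grundy value
  different from 1; a move from \<open>H\<^sub>1\<close> to an \<open>h\<close> with \<open>g(h) \<ge> 2\<close> is reverted to Grundy value 1
  inside \<open>h\<close>; and a move to an \<open>h\<close> with \<open>g(h) = 0\<close> leaves a position of Grundy value 0 which is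
  nonempty because of \<open>H\<^sub>2\<close>, so that the pass is still available and wins.

  Sprague--Grundy theory enters only through the equivalence of \<open>g(G) = n\<close> with \<open>G + *n\<close> being
  lost for the player to move (lemma \<open>grundy_eq_iff\<close>).
\<close>

section \<open>The monoid of games under disjunctive sum\<close>

lemma game_eqI: "(\<And>x. x |\<in>| options G \<longleftrightarrow> x |\<in>| options H) \<Longrightarrow> G = H"
  by (rule game.expand) (rule fset_eqI)

lemma options_zero [simp]: "options 0 = {||}"
  by (simp add: zero_game_def)

lemma in_options_plus_iff:
  "x |\<in>| options (G + H) \<longleftrightarrow>
    (\<exists>g. g |\<in>| options G \<and> x = g + H) \<or> (\<exists>h. h |\<in>| options H \<and> x = G + h)"
  by (subst plus_game.simps) auto

instance game :: comm_monoid_add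
proof
  fix a b c :: game
  show "a + b + c = a + (b + c)"
  proof (induction "size a + size b + size c" arbitrary: a b c rule: less_induct)
    case less
    have 1: "x + b + c = x + (b + c)" if "x |\<in>| options a" for x
      by (rule less) (simp add: size_option_less that)
    have 2: "a + x + c = a + (x + c)" if "x |\<in>| options b" for x
      by (rule less) (simp add: size_option_less that)
    have 3: "a + b + x = a + (b + x)" if "x |\<in>| options c" for x
      by (rule less) (simp add: size_option_less that)
    show ?case
    proof (rule game_eqI)
      fix x
      have "x |\<in>| options (a + b + c) \<longleftrightarrow>
        (\<exists>y. y |\<in>| options a \<and> x = y + b + c) \<or> (\<exists>y. y |\<in>| options b \<and> x = a + y + c)
        \<or> (\<exists>y. y |\<in>| options c \<and> x = a + b + y)"
        unfolding in_options_plus_iff by blast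
      also have "\<dots> \<longleftrightarrow>
        (\<exists>y. y |\<in>| options a \<and> x = y + (b + c)) \<or> (\<exists>y. y |\<in>| options b \<and> x = a + (y + c))
        \<or> (\<exists>y. y |\<in>| options c \<and> x = a + (b + y))"
        by (simp only: 1 2 3 cong: conj_cong)
      also have "\<dots> \<longleftrightarrow> x |\<in>| options (a + (b + c))"
        unfolding in_options_plus_iff by blast
      finally show "x |\<in>| options (a + b + c) \<longleftrightarrow> x |\<in>| options (a + (b + c))" .
    qed
  qed
  show "a + b = b + a"
  proof (induction "size a + size b" arbitrary: a b rule: less_induct)
    case less
    have 1: "x + b = b + x" if "x |\<in>| options a" for x
      by (rule less) (simp add: size_option_less that)
    have 2: "a + x = x + a" if "x |\<in>| options b" for x
      by (rule less) (simp add: size_option_less that)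
    show ?case
      by (rule game_eqI) (simp only: in_options_plus_iff 1 2 disj_commute cong: conj_cong)
  qed
  show "0 + a = a"
  proof (induction "size a" arbitrary: a rule: less_induct)
    case less
    have "0 + x = x" if "x |\<in>| options a" for x
      using less size_option_less[OF that] by simp
    then show ?case
      by (intro game_eqI) (auto simp: in_options_plus_iff)
  qed
qed

section \<open>Outcomes and Grundy values\<close>

lemma previous_wins_zero [simp]: "previous_wins 0"
  by (subst previous_wins.simps) simp

lemma not_previous_winsI: "g |\<in>| options G \<Longrightarrow> previous_wins g \<Longrightarrow> \<not> previous_wins G"
  using previous_wins.simps[of G] by blast

lemma not_previous_winsE:
  assumes "\<not> previous_wins G"
  obtains g where "g |\<in>| options G" "previous_wins g"
  using assms previous_wins.simps[of G] by blast

text \<open>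
  The winner of \<open>X\<close> keeps his strategy and answers each move in \<open>A\<close> inside \<open>A\<close>.
\<close>

lemma previous_wins_plus_cancel:
  assumes "previous_wins A"
  shows "previous_wins (A + X) \<longleftrightarrow> previous_wins X"
  using assms
proof (induction "size A + size X" arbitrary: A X rule: less_induct)
  case less
  show ?case
  proof
    assume AX: "previous_wins (A + X)"
    show "previous_wins X"
    proof (rule ccontr)
      assume "\<not> previous_wins X"
      then obtain x where x: "x |\<in>| options X" "previous_wins x"
        by (rule not_previous_winsE)
      then have "previous_wins (A + x)"
        using less size_option_less[OF x(1)] by simp
      then show False
        using AX x(1) not_previous_winsI in_options_plus_iff by blast
    qed
  next
    assume X: "previous_wins X"
    have "\<not> previous_wins (a + X)" if a: "a |\<in>| options A" for a
    proof -
      have "\<not> previous_wins a"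
        using a less.prems not_previous_winsI by blast
      then obtain a' where a': "a' |\<in>| options a" "previous_wins a'"
        by (rule not_previous_winsE)
      then have "previous_wins (a' + X)"
        using less.hyps[of a' X] X size_option_less[OF a'(1)] size_option_less[OF a] by simp
      then show ?thesis
        using a'(1) not_previous_winsI in_options_plus_iff by blast
    qed
    moreover have "\<not> previous_wins (A + x)" if x: "x |\<in>| options X" for x
    proof -
      have "\<not> previous_wins x"
        using x X not_previous_winsI by blast
      then show ?thesis
        using less.hyps[of A x] less.prems size_option_less[OF x] by simp
    qed
    ultimately show "previous_wins (A + X)"
      by (subst previous_wins.simps) (auto simp: in_options_plus_iff)
  qed
qed

lemma previous_wins_plus_self: "previous_wins (G + G)"
proof (induction "size G" arbitrary: G rule: less_induct)
  case less
  have "\<not> previous_wins (g + G)" if g: "g |\<in>| options G" for g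
    using less[OF size_option_less[OF g]] g not_previous_winsI in_options_plus_iff by blast
  moreover from this have "\<not> previous_wins (G + g)" if "g |\<in>| options G" for g
    using that by (simp only: add.commute[of G] not_False_eq_True)
  ultimately show ?case
    by (subst previous_wins.simps) (auto simp: in_options_plus_iff)
qed

lemma game_eq_iff_previous_wins_plus: "G \<doteq> H \<longleftrightarrow> previous_wins (G + H)"
proof
  assume "G \<doteq> H"
  then have "previous_wins (G + H) \<longleftrightarrow> previous_wins (H + H)"
    unfolding game_eq_def by blast
  then show "previous_wins (G + H)"
    by (simp only: previous_wins_plus_self)
next
  assume GH: "previous_wins (G + H)"
  show "G \<doteq> H"
    unfolding game_eq_def
  proof
    fix X
    have "previous_wins (G + X) \<longleftrightarrow> previous_wins ((H + H) + (G + X))"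
      by (simp only: previous_wins_plus_cancel[OF previous_wins_plus_self])
    also have "(H + H) + (G + X) = (G + H) + (H + X)"
      by (simp only: ac_simps)
    also have "previous_wins \<dots> \<longleftrightarrow> previous_wins (H + X)"
      by (rule previous_wins_plus_cancel[OF GH])
    finally show "previous_wins (G + X) \<longleftrightarrow> previous_wins (H + X)" .
  qed
qed

lemma game_eq_zero_iff: "G \<doteq> 0 \<longleftrightarrow> previous_wins G"
  by (simp add: game_eq_iff_previous_wins_plus)

lemma in_options_nimber_iff: "x |\<in>| options (nimber n) \<longleftrightarrow> (\<exists>k<n. x = nimber k)"
  by (subst nimber.simps) (auto simp: fset_of_list_elem)

lemma nimber_zero [simp]: "nimber 0 = 0"
  by (rule game_eqI) (auto simp: in_options_nimber_iff)

lemma nimber_eq_zero_iff: "nimber n = 0 \<longleftrightarrow> n = 0"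
proof
  assume "nimber n = 0"
  then have "\<not> nimber 0 |\<in>| options (nimber n)"
    by simp
  then show "n = 0"
    unfolding in_options_nimber_iff by (metis gr0I)
qed simp

lemma previous_wins_nimber_plus_iff: "previous_wins (nimber m + nimber n) \<longleftrightarrow> m = n"
proof -
  have less: "\<not> previous_wins (nimber k + nimber l)" if "k < l" for k l
  proof -
    have "nimber k + nimber k |\<in>| options (nimber k + nimber l)"
      using that unfolding in_options_plus_iff in_options_nimber_iff by blast
    then show ?thesis
      by (rule not_previous_winsI[OF _ previous_wins_plus_self])
  qed
  show ?thesis
    using less[of m n] less[of n m] previous_wins_plus_self
    by (metis add.commute nat_neq_iff)
qed

text \<open>
  Sprague--Grundy: the value is the minimal excludant of the values of the options, obtained here as
  the least \<open>n\<close> such that no option \<open>g\<close> of \<open>G\<close> has \<open>g + *n\<close> lost. It exists because each option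
  excludes only one number.
\<close>

lemma ex_previous_wins_plus_nimber: "\<exists>n. previous_wins (G + nimber n)"
proof (induction "size G" arbitrary: G rule: less_induct)
  case less
  then have "\<forall>g. \<exists>n. g |\<in>| options G \<longrightarrow> previous_wins (g + nimber n)"
    using size_option_less by blast
  then obtain v where v: "\<And>g. g |\<in>| options G \<Longrightarrow> previous_wins (g + nimber (v g))"
    by metis
  have v_unique: "n = v g" if "g |\<in>| options G" "previous_wins (g + nimber n)" for g n
  proof -
    have "previous_wins ((g + nimber n) + (g + nimber (v g)))"
      using that v previous_wins_plus_cancel by blast
    also have "(g + nimber n) + (g + nimber (v g)) = (g + g) + (nimber n + nimber (v g))"
      by (simp only: ac_simps)
    finally show ?thesis
      by (simp only: previous_wins_plus_cancel[OF previous_wins_plus_self]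
          previous_wins_nimber_plus_iff)
  qed
  let ?free = "\<lambda>n. n \<notin> v ` fset (options G)"
  have "\<exists>n. ?free n"
    using ex_new_if_finite[OF infinite_UNIV_nat, of "v ` fset (options G)"] by simp
  define n where "n = (LEAST n. ?free n)"
  have free: "?free n"
    unfolding n_def using \<open>\<exists>n. ?free n\<close> by (rule LeastI_ex)
  have taken: "\<not> ?free k" if "k < n" for k
    using that unfolding n_def by (rule not_less_Least)
  have "\<not> previous_wins (g + nimber n)" if "g |\<in>| options G" for g
    using that v_unique free by blast
  moreover have "\<not> previous_wins (G + nimber k)" if "k < n" for k
  proof -
    obtain g where "g |\<in>| options G" "k = v g"
      using taken[OF \<open>k < n\<close>] by auto
    then have "previous_wins (g + nimber k)" "g + nimber k |\<in>| options (G + nimber k)"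
      using v by (auto simp: in_options_plus_iff)
    then show ?thesis
      using not_previous_winsI by blast
  qed
  ultimately have "previous_wins (G + nimber n)"
    by (subst previous_wins.simps) (auto simp: in_options_plus_iff in_options_nimber_iff)
  then show ?case ..
qed

lemma grundy_eq_iff: "grundy G = n \<longleftrightarrow> previous_wins (G + nimber n)"
proof -
  obtain m where m: "G \<doteq> nimber m"
    using ex_previous_wins_plus_nimber game_eq_iff_previous_wins_plus by blast
  have eq: "G \<doteq> nimber k \<longleftrightarrow> m = k" for k
    using m previous_wins_nimber_plus_iff[of m k]
    by (simp add: game_eq_iff_previous_wins_plus[of G "nimber k"]) (simp add: game_eq_def)
  then have "grundy G = m"
    unfolding grundy_def by auto
  then show ?thesis
    using eq game_eq_iff_previous_wins_plus by simp
qed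

lemma grundy_eq_zero_iff: "grundy G = 0 \<longleftrightarrow> previous_wins G"
  by (simp add: grundy_eq_iff)

lemma ex_option_grundy_one:
  assumes "grundy G \<noteq> 0" "grundy G \<noteq> 1"
  obtains g where "g |\<in>| options G" "grundy g = 1"
proof -
  have "\<not> previous_wins (G + nimber 1)"
    using assms(2) grundy_eq_iff by blast
  then obtain x where x: "x |\<in>| options (G + nimber 1)" "previous_wins x"
    by (rule not_previous_winsE)
  moreover have "x \<noteq> G"
    using x(2) assms(1) by (auto simp: grundy_eq_zero_iff)
  ultimately show thesis
    using that by (auto simp: in_options_plus_iff in_options_nimber_iff grundy_eq_iff)
qed

lemma grundy_option_neq:
  assumes "g |\<in>| options G"
  shows "grundy g \<noteq> grundy G"
proof
  assume "grundy g = grundy G"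
  then have "previous_wins (g + nimber (grundy G))" "previous_wins (G + nimber (grundy G))"
    using grundy_eq_iff by blast+
  moreover have "g + nimber (grundy G) |\<in>| options (G + nimber (grundy G))"
    using assms in_options_plus_iff by blast
  ultimately show False
    using not_previous_winsI by blast
qed

text \<open>
  Since \<open>*1 + *1 = 0\<close>, two summands of value 1 cancel.
\<close>

lemma grundy_plus_two_ones:
  assumes "grundy H = 1" "grundy K = 1"
  shows "grundy (G + H + K) = grundy G"
proof -
  let ?n = "nimber (grundy G)" and ?one = "nimber 1"
  have "previous_wins (H + ?one)" "previous_wins (K + ?one)" "previous_wins (G + ?n)"
    using assms grundy_eq_iff by blast+
  then have "previous_wins ((H + ?one) + ((K + ?one) + (G + ?n)))"
    by (simp only: previous_wins_plus_cancel)
  also have "(H + ?one) + ((K + ?one) + (G + ?n)) = (?one + ?one) + (G + H + K + ?n)"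
    by (simp only: ac_simps)
  finally have "previous_wins (G + H + K + ?n)"
    by (simp only: previous_wins_plus_cancel[OF previous_wins_plus_self])
  then show ?thesis
    using grundy_eq_iff by blast
qed

lemma grundy_one_imp_plus_nonzero:
  assumes "grundy H = 1"
  shows "G + H \<noteq> 0"
proof
  assume "G + H = 0"
  have "\<not> previous_wins H"
    using assms grundy_eq_zero_iff by force
  then obtain h where "h |\<in>| options H"
    by (rule not_previous_winsE)
  then have "G + h |\<in>| options (G + H)"
    using in_options_plus_iff by blast
  then show False
    using \<open>G + H = 0\<close> by simp
qed

section \<open>Split sums\<close>

lemma split_sum_zero_right [simp]: "split_sum G 0 = G"
  by (simp add: split_sum.simps)

lemma in_options_split_sum_iff:
  assumes "G \<noteq> 0" "H \<noteq> 0"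
  shows "x |\<in>| options (split_sum G H) \<longleftrightarrow>
    (\<exists>h. h |\<in>| options H \<and> x = split_sum G h) \<or> (\<exists>g. g |\<in>| options G \<and> x = split_sum g H)"
  using assms by (subst split_sum.simps) auto

lemma previous_wins_split_one_iff:
  assumes "G \<noteq> 0"
  shows "previous_wins (split_sum G (nimber 1)) \<longleftrightarrow>
    grundy G \<noteq> 0 \<and> (\<forall>g. g |\<in>| options G \<longrightarrow> \<not> previous_wins (split_sum g (nimber 1)))"
proof -
  have "nimber 1 \<noteq> 0"
    by (simp only: nimber_eq_zero_iff)
  note opts = in_options_split_sum_iff[OF assms this]
  show ?thesis
    by (subst previous_wins.simps)
      (auto simp: opts in_options_nimber_iff grundy_eq_zero_iff simp del: One_nat_def)
qed

text \<open>
  The witness in the split value is unique because, for \<open>k < l\<close>, the position \<open>G \<circ> *k\<close> is an option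
  of \<open>G \<circ> *l\<close>. For \<open>G \<equiv> 0\<close> this fails, as every \<open>0 \<circ> *n\<close> is empty.
\<close>

lemma split_value_eq_iff:
  assumes "G \<noteq> 0"
  shows "split_value G = enat n \<longleftrightarrow> previous_wins (split_sum G (nimber n))"
proof -
  have less: "\<not> previous_wins (split_sum G (nimber l))"
    if "previous_wins (split_sum G (nimber k))" "k < l" for k l
  proof -
    have "nimber l \<noteq> 0"
      using that(2) nimber_eq_zero_iff by simp
    then have "split_sum G (nimber k) |\<in>| options (split_sum G (nimber l))"
      using assms that(2) by (auto simp: in_options_split_sum_iff in_options_nimber_iff)
    then show ?thesis
      using that(1) by (rule not_previous_winsI)
  qed
  have unique: "k = l"
    if "previous_wins (split_sum G (nimber k))" "previous_wins (split_sum G (nimber l))" for k l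
    using that less nat_neq_iff by metis
  show ?thesis
  proof (cases "\<exists>k. previous_wins (split_sum G (nimber k))")
    case True
    then obtain k where k: "previous_wins (split_sum G (nimber k))" ..
    then have "(THE k. previous_wins (split_sum G (nimber k))) = k"
      using unique by blast
    then have "split_value G = enat k"
      using True by (simp add: split_value_def game_eq_zero_iff)
    then show ?thesis
      using k unique by auto
  next
    case False
    then show ?thesis
      by (simp add: split_value_def game_eq_zero_iff)
  qed
qed

section \<open>Two summands of Grundy value one\<close>

text \<open>
  The induction runs over the total game, since both the moves that are refuted and their
  refutations lead back to positions of this shape. The pass settles the positions of value 0, and
  these have to be nonempty for it: this is why one summand of value 1 would not be enough.
\<close>

lemma previous_wins_split_one_iff_grundy:
  assumes "grundy H1 = 1" "grundy H2 = 1"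
  shows "previous_wins (split_sum (G1 + H1 + H2) (nimber 1)) \<longleftrightarrow> grundy (G1 + H1 + H2) = 1"
  using assms
proof (induction "size (G1 + H1 + H2)" arbitrary: G1 H1 H2 rule: less_induct)
  case less
  let ?G = "G1 + H1 + H2" and ?L = "\<lambda>G. previous_wins (split_sum G (nimber 1))"
  note H = less.prems
  have nonzero: "?G \<noteq> 0"
    using H(2) by (rule grundy_one_imp_plus_nonzero)
  note step = previous_wins_split_one_iff[OF nonzero]
  have val: "grundy ?G = grundy G1"
    using H by (rule grundy_plus_two_ones)
  have G1_option: "g + H1 + H2 |\<in>| options ?G" if "g |\<in>| options G1" for g
    using that unfolding in_options_plus_iff by blast
  have IH_G1: "?L (g + H1 + H2) \<longleftrightarrow> grundy g = 1" if "g |\<in>| options G1" for g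
    using less.hyps[OF size_option_less[OF G1_option[OF that]] H] grundy_plus_two_ones[OF H] by simp
  show ?case
  proof
    assume L: "?L ?G"
    show "grundy ?G = 1"
    proof (rule ccontr)
      assume "grundy ?G \<noteq> 1"
      moreover have "grundy ?G \<noteq> 0"
        using L step by blast
      ultimately obtain g where "g |\<in>| options G1" "grundy g = 1"
        using val ex_option_grundy_one by metis
      then show False
        using L step G1_option IH_G1 by blast
    qed
  next
    assume one: "grundy ?G = 1"
    \<comment> \<open>Stated for arbitrary \<open>H\<close> and \<open>K\<close>, so that it serves for a move in either summand.\<close>
    have H_move: "\<not> ?L (G1 + h + K)"
      if G: "?G = G1 + H + K" and HK: "grundy H = 1" "grundy K = 1" and h: "h |\<in>| options H"
      for H K h
    proof -
      have nonzero': "G1 + h + K \<noteq> 0"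
        using HK(2) by (rule grundy_one_imp_plus_nonzero)
      have option: "G1 + h + K |\<in>| options ?G"
        unfolding G using h unfolding in_options_plus_iff by blast
      show ?thesis
      proof (cases "grundy h = 0")
        case True
        have "previous_wins (h + ((G1 + nimber 1) + (K + nimber 1)))"
          using True HK(2) one val previous_wins_plus_cancel
          by (metis grundy_eq_iff grundy_eq_zero_iff)
        also have "h + ((G1 + nimber 1) + (K + nimber 1)) = (nimber 1 + nimber 1) + (G1 + h + K)"
          by (simp only: ac_simps)
        finally have "grundy (G1 + h + K) = 0"
          by (simp only: previous_wins_plus_cancel[OF previous_wins_plus_self] grundy_eq_zero_iff)
        then show ?thesis
          using previous_wins_split_one_iff[OF nonzero'] by blast
      next
        case False
        moreover have "grundy h \<noteq> 1"
          using grundy_option_neq[OF h] HK(1) by simp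
        ultimately obtain h' where h': "h' |\<in>| options h" "grundy h' = 1"
          by (rule ex_option_grundy_one)
        have option': "G1 + h' + K |\<in>| options (G1 + h + K)"
          using h'(1) unfolding in_options_plus_iff by blast
        have "size (G1 + h' + K) < size ?G"
          using size_option_less[OF option] size_option_less[OF option'] by simp
        moreover have "grundy (G1 + h' + K) = 1"
          using grundy_plus_two_ones[OF h'(2) HK(2)] one val by simp
        ultimately have "?L (G1 + h' + K)"
          using less.hyps h'(2) HK(2) by blast
        then show ?thesis
          using previous_wins_split_one_iff[OF nonzero'] option' by blast
      qed
    qed
    have "\<not> ?L x" if x: "x |\<in>| options ?G" for x
    proof -
      consider (G1) g where "g |\<in>| options G1" "x = g + H1 + H2"
        | (H1) h where "h |\<in>| options H1" "x = G1 + h + H2"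
        | (H2) h where "h |\<in>| options H2" "x = G1 + H1 + h"
        using x unfolding in_options_plus_iff by blast
      then show ?thesis
      proof cases
        case G1
        then show ?thesis
          using IH_G1 grundy_option_neq one val by metis
      next
        case H1
        then show ?thesis
          using H_move[OF refl H] by blast
      next
        case H2
        have "?G = G1 + H2 + H1" "x = G1 + h + H1"
          using H2(2) by (simp_all only: ac_simps)
        then show ?thesis
          using H_move[OF _ H(2,1) H2(1)] by simp
      qed
    qed
    then show "?L ?G"
      using step one by simp
  qed
qed

theorem theorem5:
  fixes G :: game
  assumes "\<exists>G1 H1 H2. grundy H1 = 1 \<and> grundy H2 = 1 \<and> G = G1 + H1 + H2"
  shows "grundy G = 1 \<longleftrightarrow> split_value G = 1"
proof -
  obtain G1 H1 H2 where H: "grundy H1 = 1" "grundy H2 = 1" and G: "G = G1 + H1 + H2"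
    using assms by blast
  have "G \<noteq> 0"
    unfolding G using H(2) by (rule grundy_one_imp_plus_nonzero)
  then have "split_value G = 1 \<longleftrightarrow> previous_wins (split_sum G (nimber 1))"
    using split_value_eq_iff[of G 1] by (simp add: one_enat_def)
  also have "\<dots> \<longleftrightarrow> grundy G = 1"
    unfolding G using H by (rule previous_wins_split_one_iff_grundy)
  finally show ?thesis ..
qed

end
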